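(* Let $(\mathcal{A},\varphi)$ be a non-commutative probability space and $\lambda\ge 0$. For each $N\geq 1$ with $N\ge\lambda$, suppose $a_1,\dots,a_N\in\mathcal{A}$ (possibly depending on $N$) are BMT independent with respect to a digraph $G_N$ with vertex set $[N]$, and each $a_i$ has Bernoulli distribution $\mu_N=(1-\frac{\lambda}{N})\delta_0+\frac{\lambda}{N}\delta_1$, i.e. $\varphi(a_i^k)=\lambda/N$ for all $k\ge1$. Then for every integer $m\ge1$, as $N\to\infty$, $$\varphi\left[(a_1+\cdots+a_N)^m\right]=\sum_{\pi\in P(m)}\lambda^{\#(\pi)}N^{-\#(\pi)}\sum_{\substack{\mathbf{i}:[m]\to[N]\\ \ker[\mathbf{i}]=\pi}}\mathbf{1}_{G_{\pi(\mathbf{i})}\subseteq G_{\mathbf{i}}}\;+\;O(N^{-1}),$$ where $G_{\mathbf{i}}$ is the restriction of $G_N$ to the vertices $i_1,\dots,i_m$, $\#(\pi)$ is the number of blocks of $\pi$, and $\mathbf{1}_{G_{\pi(\mathbf{i})}\subseteq G_{\mathbf{i}}}$ equals $1$ if $G_{\pi(\mathbf{i})}$ is a subgraph of $G_{\mathbf{i}}$ and $0$ otherwise.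
   Context: A non-commutative probability space is a pair $(\mathcal{A},\varphi)$ with $\mathcal{A}$ a complex unital algebra and $\varphi:\mathcal{A}\to\mathbb{C}$ linear with $\varphi(1)=1$. $[m]=\{1,\dots,m\}$ and $P(m)$ is the set of partitions of $[m]$. A digraph $G=(V,E)$ has a non-empty vertex set $V$ and an edge set $E\subset V\times V$ with no loops. Subgraph means inclusion of both vertex and edge sets. For $\mathbf{i}:[m]\to V$, write $i_k=\mathbf{i}(k)$. The kernel $\ker[\mathbf{i}]$ is the partition of $[m]$ given by $k\sim k'$ iff $i_k=i_{k'}$. The kernel subordinated to $G$, $\ker_G[\mathbf{i}]$, is the partition of $[m]$ given by: $k\sim k'$ iff $i_k=i_{k'}$ and $(i_\ell,i_k)\in E$ for every $\ell$ strictly between $k$ and $k'$ with $i_\ell\neq i_k$. BMT independence: a family of (not necessarily unital) subalgebras $(\mathcal{A}_i)_{i\in I}$ is BMT independent with respect to $(\varphi,G)$, $G=(I,E)$ a digraph, if for all $m\ge1$ and $a_1\in\mathcal{A}_{i_1},\dots,a_m\in\mathcal{A}_{i_m}$ one has $\varphi(a_1\cdots a_m)=\prod_{B\in\ker_G[\mathbf{i}]}\varphi((a_k)|_B)$, where $(a_k)|_B=a_{k_1}\cdots a_{k_r}$ for $B=\{k_1<\cdots<k_r\}$. Random variables $a_1,\dots,a_N$ are BMT independent with respect to $G_N$ if the subalgebras they generate (polynomials in $a_i$ without constant term) are. Nesting-crossing graph: for blocks $B\ne C$ of $\pi\in P(m)$, $B$ is nested inside $C=\{c_1<\cdots<c_s\}$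 if there is $k\in\{1,\dots,s-1\}$ with $c_k<b<c_{k+1}$ for all $b\in B$. $B$ and $C$ cross if there are $b,b'\in B$, $c,c'\in C$ with $b<c<b'<c'$ or $c<b<c'<b'$. $G_\pi$ is the digraph with vertex set $\pi$ and edges $(B,C)$, $B\neq C$, such that $B$ is nested inside $C$ or $B$ and $C$ cross; equivalently, there are $k,k'\in C$, $\ell\in B$ with $k<\ell<k'$. If $\ker[\mathbf{i}]=\pi$, $G_{\pi(\mathbf{i})}$ is obtained from $G_\pi$ by relabeling each vertex (block) $W$ as $i_k$ for $k\in W$. *)

theory Defs
  imports
    "HOL-Analysis.Analysis"
    "HOL-Library.Landau_Symbols"
    "HOL-Library.Disjoint_Sets"
    "HOL-Library.FuncSet"
    "Graph_Theory.Graph_Theory"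
begin

section \<open>Non-commutative probability spaces\<close>

text \<open>
  A complex unital algebra is a (not necessarily commutative) unital ring whose complex scalar
  multiplication is compatible with the product.  The class \<^class>\<open>ring_1\<close> excludes only the zero
  ring, on which no normalised functional exists anyway.
\<close>

locale complex_unital_algebra = vector_space smul
  for smul :: "complex \<Rightarrow> 'a::ring_1 \<Rightarrow> 'a" +
  assumes smul_mult_left: "smul c x * y = smul c (x * y)"
    and smul_mult_right: "x * smul c y = smul c (x * y)"

locale nc_probability_space = complex_unital_algebra smul
  for smul :: "complex \<Rightarrow> 'a::ring_1 \<Rightarrow> 'a" +
  fixes \<phi> :: "'a \<Rightarrow> complex"
  assumes linear: "Vector_Spaces.linear smul (*) \<phi>"
    and normalised: "\<phi> 1 = 1"

definition subalgebra :: "(complex \<Rightarrow> 'a::ring_1 \<Rightarrow> 'a) \<Rightarrow> 'a set \<Rightarrow> bool" where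
  \<comment> \<open>not necessarily unital\<close>
  "subalgebra smul S \<longleftrightarrow> module.subspace smul S \<and> (\<forall>x\<in>S. \<forall>y\<in>S. x * y \<in> S)"

definition generated_subalgebra :: "(complex \<Rightarrow> 'a::ring_1 \<Rightarrow> 'a) \<Rightarrow> 'a \<Rightarrow> 'a set" where
  "generated_subalgebra smul x = subalgebra smul hull {x}"

text \<open>It consists of the polynomials in \<open>x\<close> without constant term.\<close>

lemma (in complex_unital_algebra) generated_subalgebra_eq_span:
  "generated_subalgebra smul x = span {x ^ k | k. k \<ge> 1}"
proof -
  let ?P = "{x ^ k | k::nat. k \<ge> 1}"
  have prod: "u * v \<in> span ?P" if u: "u \<in> span ?P" and v: "v \<in> span ?P" for u v
    using u
  proof (induction rule: span_induct_alt)
    case base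
    show ?case by (simp add: span_zero)
  next
    case (step c y z)
    have "y * v \<in> span ?P"
      using v
    proof (induction rule: span_induct_alt)
      case base
      show ?case by (simp add: span_zero)
    next
      case (step d w s)
      obtain j k where "y = x ^ j" "w = x ^ k" "j \<ge> 1" "k \<ge> 1"
        using step(1) \<open>y \<in> ?P\<close> by blast
      then have "y * w \<in> ?P"
        by (auto simp flip: power_add intro!: exI[of _ "j + k"])
      then show ?case
        using step by (simp add: distrib_left smul_mult_right span_add span_scale span_base)
    qed
    then show ?case
      using step by (simp add: distrib_right smul_mult_left span_add span_scale)
  qed
  have powers: "x ^ k \<in> S" if S: "subalgebra smul S" "x \<in> S" and k: "k \<ge> 1" for S and k :: nat
    using k
  proof (induction k rule: dec_induct)
    case base
    show ?case using S by simp
  next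
    case (step n)
    then show ?case using S by (simp add: subalgebra_def)
  qed
  show ?thesis
    unfolding generated_subalgebra_def
  proof (rule hull_unique)
    show "{x} \<subseteq> span ?P"
      using span_base[of x ?P] by (metis (mono_tags, lifting) empty_subsetI insert_subset
          mem_Collect_eq order_refl power_one_right)
    show "subalgebra smul (span ?P)"
      using prod by (simp add: subalgebra_def subspace_span)
    show "span ?P \<subseteq> S" if "{x} \<subseteq> S" "subalgebra smul S" for S
      using that powers[of S] by (intro span_minimal) (auto simp: subalgebra_def)
  qed
qed


section \<open>Kernels and BMT independence\<close>

definition ker :: "nat \<Rightarrow> (nat \<Rightarrow> 'v) \<Rightarrow> nat set set" where
  "ker m i = {1..m} // {(k, k'). k \<in> {1..m} \<and> k' \<in> {1..m} \<and> i k = i k'}"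

text \<open>``Strictly between'' is meant irrespective of the order of the two end points.\<close>

definition ker_rel_G :: "'v pair_pre_digraph \<Rightarrow> nat \<Rightarrow> (nat \<Rightarrow> 'v) \<Rightarrow> nat rel" where
  "ker_rel_G G m i = {(k, k'). k \<in> {1..m} \<and> k' \<in> {1..m} \<and> i k = i k' \<and>
     (\<forall>l. min k k' < l \<and> l < max k k' \<and> i l \<noteq> i k \<longrightarrow> (i l, i k) \<in> parcs G)}"

definition ker_G :: "'v pair_pre_digraph \<Rightarrow> nat \<Rightarrow> (nat \<Rightarrow> 'v) \<Rightarrow> nat set set" where
  "ker_G G m i = {1..m} // ker_rel_G G m i"

lemma equiv_ker_rel_G: "equiv {1..m} (ker_rel_G G m i)"
proof (rule equivI)
  show "trans (ker_rel_G G m i)"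
  proof (rule transI)
    fix x y z assume xy: "(x, y) \<in> ker_rel_G G m i" and yz: "(y, z) \<in> ker_rel_G G m i"
    have "(i l, i x) \<in> parcs G" if l: "min x z < l" "l < max x z" "i l \<noteq> i x" for l
    proof -
      have "i x = i y" using xy by (simp add: ker_rel_G_def)
      then have "l \<noteq> y" using l by auto
      then have "(min x y < l \<and> l < max x y) \<or> (min y z < l \<and> l < max y z)"
        using l by (auto simp: min_def max_def split: if_splits)
      then show ?thesis
        using xy yz l(3) \<open>i x = i y\<close> by (auto simp: ker_rel_G_def)
    qed
    then show "(x, z) \<in> ker_rel_G G m i"
      using xy yz by (auto simp: ker_rel_G_def)
  qed
qed (auto simp: ker_rel_G_def refl_on_def sym_def min.commute max.commute)

definition ordered_prod :: "(nat \<Rightarrow> 'a::monoid_mult) \<Rightarrow> nat set \<Rightarrow> 'a" where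
  \<comment> \<open>product in increasing order of the indices; meant for finite index sets\<close>
  "ordered_prod a B = prod_list (map a (sorted_list_of_set B))"

definition bmt_independent_subalgebras ::
    "(complex \<Rightarrow> 'a::ring_1 \<Rightarrow> 'a) \<Rightarrow> ('a \<Rightarrow> complex) \<Rightarrow> 'v pair_pre_digraph \<Rightarrow> ('v \<Rightarrow> 'a set) \<Rightarrow> bool"
  where
  "bmt_independent_subalgebras smul \<phi> G \<A> \<longleftrightarrow>
     (\<forall>v\<in>pverts G. subalgebra smul (\<A> v)) \<and>
     (\<forall>m i a. m \<ge> 1 \<longrightarrow> (\<forall>k\<in>{1..m}. i k \<in> pverts G \<and> a k \<in> \<A> (i k)) \<longrightarrow>
        \<phi> (ordered_prod a {1..m}) = (\<Prod>B\<in>ker_G G m i. \<phi> (ordered_prod a B)))"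

definition bmt_independent ::
    "(complex \<Rightarrow> 'a::ring_1 \<Rightarrow> 'a) \<Rightarrow> ('a \<Rightarrow> complex) \<Rightarrow> 'v pair_pre_digraph \<Rightarrow> ('v \<Rightarrow> 'a) \<Rightarrow> bool"
  where
  "bmt_independent smul \<phi> G a \<longleftrightarrow>
     bmt_independent_subalgebras smul \<phi> G (\<lambda>v. generated_subalgebra smul (a v))"


section \<open>Nesting-crossing graphs\<close>

text \<open>
  \<open>B\<close> lies in a gap between two consecutive elements of \<open>C\<close>.
\<close>

definition nested_inside :: "nat set \<Rightarrow> nat set \<Rightarrow> bool" where
  "nested_inside B C \<longleftrightarrow>
     (\<exists>c\<in>C. \<exists>c'\<in>C. c < c' \<and> (\<forall>x\<in>C. \<not> (c < x \<and> x < c')) \<and> (\<forall>b\<in>B. c < b \<and> b < c'))"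

definition crossing :: "nat set \<Rightarrow> nat set \<Rightarrow> bool" where
  "crossing B C \<longleftrightarrow> (\<exists>b\<in>B. \<exists>b'\<in>B. \<exists>c\<in>C. \<exists>c'\<in>C.
     (b < c \<and> c < b' \<and> b' < c') \<or> (c < b \<and> b < c' \<and> c' < b'))"

definition nesting_crossing_graph :: "nat set set \<Rightarrow> nat set pair_pre_digraph" where
  "nesting_crossing_graph \<pi> = \<lparr>pverts = \<pi>,
     parcs = {(B, C). B \<in> \<pi> \<and> C \<in> \<pi> \<and> B \<noteq> C \<and> (nested_inside B C \<or> crossing B C)}\<rparr>"

lemma nested_or_crossing_iff:
  assumes "finite C" "B \<noteq> {}" "B \<inter> C = {}"
  shows "nested_inside B C \<or> crossing B C \<longleftrightarrow> (\<exists>k\<in>C. \<exists>k'\<in>C. \<exists>l\<in>B. k < l \<and> l < k')"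
proof
  assume "nested_inside B C \<or> crossing B C"
  then show "\<exists>k\<in>C. \<exists>k'\<in>C. \<exists>l\<in>B. k < l \<and> l < k'"
  proof
    assume "nested_inside B C"
    moreover obtain b where "b \<in> B" using assms(2) by blast
    ultimately show ?thesis unfolding nested_inside_def by blast
  next
    assume "crossing B C"
    then show ?thesis unfolding crossing_def by blast
  qed
next
  assume "\<exists>k\<in>C. \<exists>k'\<in>C. \<exists>l\<in>B. k < l \<and> l < k'"
  then obtain k k' l where kl: "k \<in> C" "k' \<in> C" "l \<in> B" "k < l" "l < k'" by blast
  define c where "c = Max {x\<in>C. x < l}"
  define c' where "c' = Min {x\<in>C. l < x}"
  have "c \<in> {x\<in>C. x < l}" unfolding c_def using kl assms(1) by (intro Max_in) auto
  then have c: "c \<in> C" "c < l" by auto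
  have "c' \<in> {x\<in>C. l < x}" unfolding c'_def using kl assms(1) by (intro Min_in) auto
  then have c': "c' \<in> C" "l < c'" by auto
  have gap: "x \<le> c \<or> c' \<le> x" if "x \<in> C" for x
  proof (cases "x < l")
    case True
    then show ?thesis using that assms(1) by (auto simp: c_def)
  next
    case False
    then have "l < x" using that kl(3) assms(3) by (metis disjoint_iff linorder_neqE_nat)
    then show ?thesis using that assms(1) by (auto simp: c'_def)
  qed
  show "nested_inside B C \<or> crossing B C"
  proof (cases "\<forall>b\<in>B. c < b \<and> b < c'")
    case True
    then show ?thesis
      using c c' gap unfolding nested_inside_def by (meson leD less_trans)
  next
    case False
    then obtain b where b: "b \<in> B" "b \<le> c \<or> c' \<le> b" by (meson not_less)
    then have "b < c \<or> c' < b" using c c' assms(3) by (metis disjoint_iff le_neq_implies_less)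
    then show ?thesis
      using b c c' kl(3) unfolding crossing_def by blast
  qed
qed

text \<open>
  Each block \<open>W\<close> is relabelled as the single value that \<open>i\<close> takes on it; this is meaningful for
  \<open>\<pi> = ker m i\<close>.
\<close>

definition block_label :: "(nat \<Rightarrow> 'v) \<Rightarrow> nat set \<Rightarrow> 'v" where
  "block_label i W = the_elem (i ` W)"

definition relabelled_graph :: "nat set set \<Rightarrow> (nat \<Rightarrow> 'v) \<Rightarrow> 'v pair_pre_digraph" where
  "relabelled_graph \<pi> i = \<lparr>pverts = block_label i ` pverts (nesting_crossing_graph \<pi>),
     parcs = map_prod (block_label i) (block_label i) ` parcs (nesting_crossing_graph \<pi>)\<rparr>"

end

theory Submission
  imports Defs
begin

text \<open>
  Expand the \<open>m\<close>-th power over all \<open>i : [m] \<rightarrow> [N]\<close>.  By independence the term of \<open>i\<close> is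
  \<open>(\<lambda>/N)\<^sup>b\<close> with \<open>b\<close> the number of blocks of the kernel subordinated to \<open>G\<close>.  That kernel
  refines \<open>ker m i\<close>, with equality exactly when the relabelled graph is a subgraph of \<open>G\<close>; so an
  index outside the main term contributes at most \<open>(\<lambda>/N)\<^sup>#\<^sup>\<pi>\<^sup>+\<^sup>1\<close> with \<open>\<pi> = ker m i\<close>.  Since only
  \<open>N\<^sup>#\<^sup>\<pi>\<close> indices share the kernel \<open>\<pi>\<close>, all of them together contribute \<open>O(1/N)\<close>.
\<close>

section \<open>Ordered products and the expansion of a power of a sum\<close>

lemma ordered_prod_Suc:
  "ordered_prod a {1..Suc n} = ordered_prod a {1..n} * a (Suc n)"
  by (simp add: ordered_prod_def sorted_list_of_set_range flip: atLeastLessThanSuc_atLeastAtMost)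

lemma ordered_prod_cong:
  assumes "finite B" "\<And>k. k \<in> B \<Longrightarrow> a k = b k"
  shows "ordered_prod a B = ordered_prod b B"
  unfolding ordered_prod_def using assms by (intro arg_cong[where f = prod_list] map_cong) auto

lemma ordered_prod_const:
  assumes "finite B" "\<And>k. k \<in> B \<Longrightarrow> a k = x"
  shows "ordered_prod a B = x ^ card B"
proof -
  have "map a (sorted_list_of_set B) = replicate (card B) x"
    using assms by (intro replicate_eqI) auto
  then show ?thesis
    by (simp add: ordered_prod_def prod_list_replicate)
qed

text \<open>Induction on \<open>m\<close>, splitting off the last factor on the right, since the
  factors need not commute.\<close>

lemma sum_power_eq_sum_ordered_prod:
  fixes x :: "'v \<Rightarrow> 'a::ring_1"
  assumes "finite V"
  shows "(\<Sum>v\<in>V. x v) ^ m = (\<Sum>i\<in>{1..m} \<rightarrow>\<^sub>E V. ordered_prod (\<lambda>k. x (i k)) {1..m})"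
proof (induction m)
  case 0
  show ?case by (simp add: ordered_prod_def)
next
  case (Suc m)
  let ?D = "{1..m} \<rightarrow>\<^sub>E V" and ?u = "\<lambda>(v, g). (g :: nat \<Rightarrow> 'v)(Suc m := v)"
  have eq: "{1..Suc m} = insert (Suc m) {1..m}" by auto
  \<comment> \<open>Each index on \<open>{1..Suc m}\<close> arises exactly once by extending an
    index on \<open>{1..m}\<close> with a last value \<open>v\<close>; injectivity holds because
    \<open>Suc m\<close> lies outside \<open>{1..m}\<close>.\<close>
  have "(\<Sum>i\<in>{1..Suc m} \<rightarrow>\<^sub>E V. ordered_prod (\<lambda>k. x (i k)) {1..Suc m}) =
      (\<Sum>p\<in>V \<times> ?D. ordered_prod (\<lambda>k. x (?u p k)) {1..Suc m})"
    unfolding eq PiE_insert_eq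
    by (subst sum.reindex) (auto intro!: inj_combinator)
  also have "\<dots> = (\<Sum>(v, g)\<in>V \<times> ?D. ordered_prod (\<lambda>k. x (g k)) {1..m} * x v)"
  proof (rule sum.cong[OF refl], clarsimp simp only: split_beta prod.sel)
    fix v and g :: "nat \<Rightarrow> 'v"
    have "ordered_prod (\<lambda>k. x ((g(Suc m := v)) k)) {1..m} = ordered_prod (\<lambda>k. x (g k)) {1..m}"
      by (rule ordered_prod_cong) auto
    then show "ordered_prod (\<lambda>k. x ((g(Suc m := v)) k)) {1..Suc m} =
        ordered_prod (\<lambda>k. x (g k)) {1..m} * x v"
      by (simp only: ordered_prod_Suc fun_upd_same)
  qed
  also have "\<dots> = (\<Sum>v\<in>V. (\<Sum>g\<in>?D. ordered_prod (\<lambda>k. x (g k)) {1..m}) * x v)"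
    by (simp add: sum.cartesian_product sum_distrib_right)
  also have "\<dots> = (\<Sum>v\<in>V. x v) ^ Suc m"
    by (simp only: Suc.IH[symmetric] power_Suc2 sum_distrib_left)
  finally show ?case by simp
qed

section \<open>Class counts under refinement\<close>

text \<open>Saturation by \<open>S\<close> maps the \<open>R\<close>-classes onto the
  \<open>S\<close>-classes. With equal finite cardinalities it would be injective, yet a pair in
  \<open>S\<close> but not in \<open>R\<close> gives two \<open>R\<close>-classes with the same
  image.\<close>

lemma card_quotient_strict_mono:
  assumes A: "finite A" and R: "equiv A R" and S: "equiv A S" and "R \<subset> S"
  shows "card (A // S) < card (A // R)"
proof -
  have cls: "S `` (R `` {x}) = S `` {x}" if "x \<in> A" for x
    using that \<open>R \<subset> S\<close> equiv_class_eq_iff[OF R] equiv_class_eq_iff[OF S] S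
    by (auto simp: equiv_def refl_on_def intro: transD symD)
  have img: "(\<lambda>X. S `` X) ` (A // R) = A // S"
    using cls by (auto simp: quotient_def image_iff)
  have fin: "finite (A // R)"
    using A R by (simp add: finite_quotient equiv_type)
  have "card (A // S) \<noteq> card (A // R)"
  proof
    assume "card (A // S) = card (A // R)"
    then have inj: "inj_on (\<lambda>X. S `` X) (A // R)"
      using fin img by (intro eq_card_imp_inj_on) auto
    obtain x y where xy: "(x, y) \<in> S" "(x, y) \<notin> R" using \<open>R \<subset> S\<close> by auto
    then have "x \<in> A" "y \<in> A" using equiv_type[OF S] by auto
    moreover have "S `` {x} = S `` {y}" using S xy by (simp add: equiv_class_eq)
    ultimately have "R `` {x} = R `` {y}"
      using cls quotientI[of _ A R] by (metis inj_onD[OF inj])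
    then show False using xy R \<open>x \<in> A\<close> \<open>y \<in> A\<close> by (auto simp: eq_equiv_class_iff)
  qed
  moreover have "card (A // S) \<le> card (A // R)"
    using fin img by (metis card_image_le)
  ultimately show ?thesis by simp
qed

section \<open>Blocks of the kernel and the number of indices with a given kernel\<close>

definition ker_rel :: "nat \<Rightarrow> (nat \<Rightarrow> 'v) \<Rightarrow> nat rel" where
  "ker_rel m i = {(k, k'). k \<in> {1..m} \<and> k' \<in> {1..m} \<and> i k = i k'}"

lemma ker_eq_quotient: "ker m i = {1..m} // ker_rel m i"
  by (simp add: ker_def ker_rel_def)

lemma equiv_ker_rel: "equiv {1..m} (ker_rel m i)"
  by (rule equivI) (auto simp: ker_rel_def refl_on_def sym_def trans_def)

lemma ker_rel_G_subset: "ker_rel_G G m i \<subseteq> ker_rel m i"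
  by (auto simp: ker_rel_G_def ker_rel_def)

lemma partition_on_ker: "partition_on {1..m} (ker m i)"
  unfolding ker_eq_quotient using equiv_ker_rel by (rule partition_on_quotient)

lemma ex_ker_block: "k \<in> {1..m} \<Longrightarrow> \<exists>B\<in>ker m i. k \<in> B"
  using partition_onD1[OF partition_on_ker[of m i]] by auto

lemma ker_blockD:
  assumes "B \<in> ker m i"
  shows "finite B" "B \<noteq> {}" "B \<subseteq> {1..m}" "k \<in> B \<Longrightarrow> k' \<in> B \<Longrightarrow> i k = i k'"
    "k \<in> B \<Longrightarrow> k' \<in> {1..m} \<Longrightarrow> i k = i k' \<Longrightarrow> k' \<in> B"
  using assms unfolding ker_def by (auto simp: quotient_def intro: finite_subset[of _ "{1..m}"])

lemma block_label_eq:
  assumes "B \<in> ker m i" "k \<in> B"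
  shows "block_label i B = i k"
proof -
  have "i ` B = {i k}" using assms ker_blockD(4)[OF assms(1)] by blast
  then show ?thesis by (simp add: block_label_def)
qed

lemma finite_ker: "finite (ker m i)"
  using finite_elements[OF _ partition_on_ker] by blast

text \<open>An index with kernel \<open>\<pi>\<close> is determined by its labels on the blocks, so
  the fibre embeds into the functions from \<open>\<pi>\<close> to \<open>V\<close>. Labels of
  distinct blocks differ, but this upper bound suffices.\<close>

lemma card_ker_fibre_le:
  fixes V :: "'v set"
  assumes "finite V"
  shows "card {i \<in> {1..m} \<rightarrow>\<^sub>E V. ker m i = \<pi>} \<le> card V ^ card \<pi>" (is "card ?F \<le> _")
\<comment> \<open>\<open>\<pi>\<close> is an arbitrary set of sets here; its finiteness is read off
  from some \<open>i0\<close> having it as kernel. An empty fibre has cardinality 0.\<close>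
proof (cases "?F = {}")
  case False
  then obtain i0 :: "nat \<Rightarrow> 'v" where i0: "ker m i0 = \<pi>" by auto
  then have fin: "finite \<pi>" using finite_ker by blast
  have "inj_on (\<lambda>i. \<lambda>B\<in>\<pi>. block_label i B) ?F"
  proof (rule inj_onI)
    fix i j assume ij: "i \<in> ?F" "j \<in> ?F"
      and eq: "(\<lambda>B\<in>\<pi>. block_label i B) = (\<lambda>B\<in>\<pi>. block_label j B)"
    have "i \<in> {1..m} \<rightarrow>\<^sub>E V" "j \<in> {1..m} \<rightarrow>\<^sub>E V" using ij by auto
    then show "i = j"
    proof (rule PiE_ext)
      fix k assume "k \<in> {1..m}"
      then obtain B where B: "B \<in> \<pi>" "k \<in> B" using ex_ker_block i0 by blast
      then have "block_label i B = i k" "block_label j B = j k"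
        using ij by (auto intro: block_label_eq)
      then show "i k = j k" using fun_cong[OF eq, of B] B by simp
    qed
  qed
  moreover have "(\<lambda>i. \<lambda>B\<in>\<pi>. block_label i B) ` ?F \<subseteq> \<pi> \<rightarrow>\<^sub>E V"
  proof clarsimp
    fix i B assume i: "i \<in> {Suc 0..m} \<rightarrow>\<^sub>E V" and B: "B \<in> ker m i"
    obtain k where k: "k \<in> B" using ker_blockD(2)[OF B] by blast
    then have "k \<in> {1..m}" using ker_blockD(3)[OF B] by blast
    then show "block_label i B \<in> V"
      using i block_label_eq[OF B k] by (auto simp: PiE_def Pi_def)
  qed
  ultimately have "card ?F \<le> card (\<pi> \<rightarrow>\<^sub>E V)"
    using fin assms by (intro card_inj_on_le) (auto intro: finite_PiE)
  then show ?thesis using fin by (simp add: card_PiE)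
next
  case True
  show ?thesis unfolding True by simp
qed

section \<open>The subgraph condition as equality of the two kernels\<close>

lemma nesting_crossing_ker_iff:
  "(B, C) \<in> parcs (nesting_crossing_graph (ker m i)) \<longleftrightarrow>
     B \<in> ker m i \<and> C \<in> ker m i \<and> B \<noteq> C \<and> (\<exists>k\<in>C. \<exists>k'\<in>C. \<exists>l\<in>B. k < l \<and> l < k')"
proof -
  have "nested_inside B C \<or> crossing B C \<longleftrightarrow> (\<exists>k\<in>C. \<exists>k'\<in>C. \<exists>l\<in>B. k < l \<and> l < k')"
    if "B \<in> ker m i" "C \<in> ker m i" "B \<noteq> C"
    using that ker_blockD(1)[OF that(2)] ker_blockD(2)[OF that(1)]
      partition_onD2[OF partition_on_ker[of m i]]
    by (intro nested_or_crossing_iff) (auto dest: disjointD)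
  then show ?thesis by (auto simp: nesting_crossing_graph_def)
qed

text \<open>An edge \<open>(B, C)\<close> of the nesting-crossing graph comes from some
  \<open>l\<close> in \<open>B\<close> between \<open>k\<close> and \<open>k'\<close> in
  \<open>C\<close>. Its relabelling \<open>(i l, i k)\<close> is exactly the arc that
  \<open>ker_rel_G\<close> demands in order to keep \<open>k\<close> and \<open>k'\<close>
  together.\<close>

lemma subgraph_relabelled_iff:
  "subgraph (with_proj (relabelled_graph (ker m i) i)) (with_proj G \<restriction> (i ` {1..m})) \<longleftrightarrow>
     ker_rel_G G m i = ker_rel m i" (is "?sub \<longleftrightarrow> _")
proof -
  let ?E = "parcs (nesting_crossing_graph (ker m i))"
  have label: "block_label i B \<in> i ` {1..m}" if "B \<in> ker m i" for B
    using that ker_blockD(2,3)[OF that] block_label_eq[OF that] by blast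
  have "?sub \<longleftrightarrow> (\<forall>(B, C)\<in>?E. (block_label i B, block_label i C) \<in> parcs G)"
    using label
    by (fastforce simp: subgraph_def relabelled_graph_def compatible_def wf_digraph_def
        induce_subgraph_def nesting_crossing_graph_def)
  also have "\<dots> \<longleftrightarrow> ker_rel m i \<subseteq> ker_rel_G G m i"
  proof safe
    fix k k'
    assume E: "\<forall>(B, C)\<in>?E. (block_label i B, block_label i C) \<in> parcs G"
      and kk': "(k, k') \<in> ker_rel m i"
    have "(i l, i k) \<in> parcs G" if l: "min k k' < l" "l < max k k'" "i l \<noteq> i k" for l
    proof -
      have km: "k \<in> {1..m}" "k' \<in> {1..m}" "i k = i k'" using kk' by (auto simp: ker_rel_def)
      then have "l \<in> {1..m}" using l by auto
      then obtain B where B: "B \<in> ker m i" "l \<in> B" using ex_ker_block by blast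
      obtain C where C: "C \<in> ker m i" "k \<in> C" using km ex_ker_block by blast
      have "k' \<in> C" using ker_blockD(5)[OF C(1)] C(2) km by blast
      \<comment> \<open>\<open>k\<close> and \<open>k'\<close> come in no fixed order, so their
        minimum and maximum serve as the two points of \<open>C\<close> around
        \<open>l\<close>.\<close>
      then have "min k k' \<in> C" "max k k' \<in> C" using C by (auto simp: min_def max_def)
      moreover have "B \<noteq> C" using B C l(3) ker_blockD(4) by metis
      ultimately have "(B, C) \<in> ?E" using B C l unfolding nesting_crossing_ker_iff by blast
      then show ?thesis using E B C by (auto simp: block_label_eq)
    qed
    then show "(k, k') \<in> ker_rel_G G m i"
      using kk' by (auto simp: ker_rel_G_def ker_rel_def)
  next
    fix B C
    assume sub: "ker_rel m i \<subseteq> ker_rel_G G m i" and "(B, C) \<in> ?E"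
    then obtain k k' l where B: "B \<in> ker m i" and C: "C \<in> ker m i" and "B \<noteq> C"
      and k: "k \<in> C" "k' \<in> C" "l \<in> B" "k < l" "l < k'"
      unfolding nesting_crossing_ker_iff by blast
    \<comment> \<open>Equal values would put \<open>l\<close> into \<open>C\<close> as well, against
      the disjointness of distinct blocks.\<close>
    have "i l \<noteq> i k"
      using \<open>B \<noteq> C\<close> B C k ker_blockD(3,5) partition_onD2[OF partition_on_ker[of m i]]
      by (metis disjointD disjoint_iff subsetD)
    moreover have "(k, k') \<in> ker_rel m i"
      using k C ker_blockD(3,4)[OF C] unfolding ker_rel_def by blast
    then have "(k, k') \<in> ker_rel_G G m i" using sub by blast
    ultimately have "(i l, i k) \<in> parcs G" using k by (auto simp: ker_rel_G_def)
    then show "(block_label i B, block_label i C) \<in> parcs G"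
      using block_label_eq[OF B] block_label_eq[OF C] k by simp
  qed
  finally show ?thesis using ker_rel_G_subset by blast
qed

text \<open>The gain of at least one block is the source of the additional factor
  \<open>lam / N\<close> in the error.\<close>

lemma ker_G_eq_or_card_less:
  "ker_rel_G G m i = ker_rel m i \<or> card (ker m i) < card (ker_G G m i)"
  using card_quotient_strict_mono[OF _ equiv_ker_rel_G equiv_ker_rel] ker_rel_G_subset
  unfolding ker_eq_quotient ker_G_def by (metis finite_atLeastAtMost psubsetI)

section \<open>Mixed moments and the error of a single index\<close>

text \<open>Within a block of \<open>ker_G\<close> all factors are the same variable, so the block
  contributes the moment of a power of it, which is \<open>x\<close> whatever the exponent.\<close>

lemma bmt_independent_moment:
  fixes G :: "'v pair_pre_digraph"
  assumes ind: "bmt_independent smul \<phi> G a" and "m \<ge> 1"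
    and i: "\<And>k. k \<in> {1..m} \<Longrightarrow> i k \<in> pverts G"
    and mom: "\<And>v k. v \<in> pverts G \<Longrightarrow> k \<ge> 1 \<Longrightarrow> \<phi> (a v ^ k) = x"
  shows "\<phi> (ordered_prod (\<lambda>k. a (i k)) {1..m}) = x ^ card (ker_G G m i)"
proof -
  have "a v \<in> generated_subalgebra smul (a v)" for v
    unfolding generated_subalgebra_def using hull_subset[of "{a v}"] by blast
  then have alg: "\<forall>k\<in>{1..m}. i k \<in> pverts G \<and> a (i k) \<in> generated_subalgebra smul (a (i k))"
    using i by blast
  have "\<phi> (ordered_prod b {1..m}) = (\<Prod>B\<in>ker_G G m i. \<phi> (ordered_prod b B))"
    if "\<forall>k\<in>{1..m}. i k \<in> pverts G \<and> b k \<in> generated_subalgebra smul (a (i k))" for b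
    using ind \<open>m \<ge> 1\<close> that
    unfolding bmt_independent_def bmt_independent_subalgebras_def by blast
  from this[OF alg] have "\<phi> (ordered_prod (\<lambda>k. a (i k)) {1..m}) =
      (\<Prod>B\<in>ker_G G m i. \<phi> (ordered_prod (\<lambda>k. a (i k)) B))" .
  also have "\<dots> = (\<Prod>B\<in>ker_G G m i. x)"
  proof (rule prod.cong)
    fix B assume B: "B \<in> ker_G G m i"
    then obtain k where k: "k \<in> {1..m}" "B = ker_rel_G G m i `` {k}"
      by (auto simp: ker_G_def quotient_def)
    then have "k \<in> B" by (auto simp: ker_rel_G_def)
    moreover have "finite B"
      using k by (auto simp: ker_rel_G_def intro: finite_subset[of _ "{1..m}"])
    \<comment> \<open>The moments are prescribed for positive exponents only, so non-emptiness of
      the block matters.\<close>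
    ultimately have "card B \<ge> 1" using card_gt_0_iff[of B] by fastforce
    have "ordered_prod (\<lambda>k. a (i k)) B = a (i k) ^ card B"
      using \<open>finite B\<close> k by (intro ordered_prod_const) (auto simp: ker_rel_G_def)
    then show "\<phi> (ordered_prod (\<lambda>k. a (i k)) B) = x"
      using mom i k(1) \<open>card B \<ge> 1\<close> by simp
  qed simp
  finally show ?thesis by simp
qed

text \<open>If the kernels agree, the two terms cancel. Otherwise the indicator vanishes and the
  remaining power has at least one more factor \<open>t\<close>; powers decrease because
  \<open>t \<le> 1\<close>.\<close>

lemma ker_G_moment_error_bound:
  fixes t :: real
  assumes "0 \<le> t" "t \<le> 1"
  shows "norm (complex_of_real t ^ card (ker_G G m i) -
      complex_of_real (t ^ card (ker m i)) *
        of_bool (subgraph (with_proj (relabelled_graph (ker m i) i))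
                          (with_proj G \<restriction> (i ` {1..m}))))
    \<le> t ^ (card (ker m i) + 1)"
proof (cases "ker_rel_G G m i = ker_rel m i")
  case True
  then have "ker_G G m i = ker m i" by (simp add: ker_G_def ker_eq_quotient)
  then show ?thesis using True assms by (simp only: subgraph_relabelled_iff) simp
next
  case False
  then have "card (ker m i) + 1 \<le> card (ker_G G m i)"
    using ker_G_eq_or_card_less[of G m i] by auto
  then have "t ^ card (ker_G G m i) \<le> t ^ (card (ker m i) + 1)"
    using assms by (intro power_decreasing)
  then show ?thesis
    using False assms by (simp only: subgraph_relabelled_iff) (simp add: norm_power)
qed

section \<open>Summation over all indices and the asymptotic bound\<close>

theorem theorem6p1:
  fixes smul :: "complex \<Rightarrow> 'a::ring_1 \<Rightarrow> 'a"
    and \<phi> :: "'a \<Rightarrow> complex"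
    and lam :: real
    and a :: "nat \<Rightarrow> nat \<Rightarrow> 'a"
    and G :: "nat \<Rightarrow> nat pair_pre_digraph"
    and m :: nat
  assumes "nc_probability_space smul \<phi>"
    and "lam \<ge> 0"
    and "\<And>N. N \<ge> 1 \<Longrightarrow> real N \<ge> lam \<Longrightarrow> pair_digraph (G N)"
    and "\<And>N. N \<ge> 1 \<Longrightarrow> real N \<ge> lam \<Longrightarrow> pverts (G N) = {1..N}"
    and "\<And>N. N \<ge> 1 \<Longrightarrow> real N \<ge> lam \<Longrightarrow> bmt_independent smul \<phi> (G N) (a N)"
    and "\<And>N i k. N \<ge> 1 \<Longrightarrow> real N \<ge> lam \<Longrightarrow> i \<in> {1..N} \<Longrightarrow> k \<ge> 1 \<Longrightarrow>
           \<phi> (a N i ^ k) = complex_of_real (lam / real N)"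
    and "m \<ge> 1"
  shows "(\<lambda>N. \<phi> ((\<Sum>i=1..N. a N i) ^ m) -
            (\<Sum>\<pi> | partition_on {1..m} \<pi>.
               complex_of_real (lam ^ card \<pi> * inverse (real N ^ card \<pi>)) *
               (\<Sum>i | i \<in> {1..m} \<rightarrow>\<^sub>E {1..N} \<and> ker m i = \<pi>.
                  of_bool (subgraph (with_proj (relabelled_graph \<pi> i))
                                    (with_proj (G N) \<restriction> (i ` {1..m}))))))
         \<in> O(\<lambda>N. complex_of_real (inverse (real N)))"
proof (rule bigoI)
  let ?P = "{\<pi>. partition_on {1..m} \<pi>}"
  \<comment> \<open>In the fibre of \<open>\<pi>\<close>, at most \<open>N ^ card \<pi>\<close>
    indices have error at most \<open>(lam / N) ^ (card \<pi> + 1)\<close> each, leaving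
    \<open>lam ^ (card \<pi> + 1) / N\<close>.\<close>
  define C where "C = (\<Sum>\<pi>\<in>?P. lam ^ (card \<pi> + 1))"
  have "norm (\<phi> ((\<Sum>i=1..N. a N i) ^ m) -
            (\<Sum>\<pi> | partition_on {1..m} \<pi>.
               complex_of_real (lam ^ card \<pi> * inverse (real N ^ card \<pi>)) *
               (\<Sum>i | i \<in> {1..m} \<rightarrow>\<^sub>E {1..N} \<and> ker m i = \<pi>.
                  of_bool (subgraph (with_proj (relabelled_graph \<pi> i))
                                    (with_proj (G N) \<restriction> (i ` {1..m}))))))
         \<le> C * norm (complex_of_real (inverse (real N)))"
    (is "norm (?L - ?R) \<le> _") if N: "N \<ge> 1" "real N \<ge> lam" for N
  proof -
    let ?D = "{1..m} \<rightarrow>\<^sub>E {1..N}"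
    define t where "t = lam / real N"
    define b :: "(nat \<Rightarrow> nat) \<Rightarrow> complex" where
      "b i = of_bool (subgraph (with_proj (relabelled_graph (ker m i) i))
                               (with_proj (G N) \<restriction> (i ` {1..m})))" for i
    define e where
      "e i = complex_of_real t ^ card (ker_G (G N) m i) - complex_of_real (t ^ card (ker m i)) * b i"
      for i
    \<comment> \<open>This is where \<open>real N \<ge> lam\<close> enters the estimate.\<close>
    have t: "0 \<le> t" "t \<le> 1" using N assms(2) by (auto simp: t_def)
    interpret nc_probability_space smul \<phi> by fact
    interpret L: Vector_Spaces.linear smul "(*)" \<phi> by (rule linear)
    have finD: "finite ?D" by (intro finite_PiE) auto
    have finP: "finite ?P" by (simp add: finitely_many_partition_on)
    \<comment> \<open>Every index lies in the fibre of exactly one partition, its own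
      kernel.\<close>
    have group: "(\<Sum>\<pi>\<in>?P. \<Sum>i | i \<in> ?D \<and> ker m i = \<pi>. f i) = sum f ?D"
      for f :: "_ \<Rightarrow> 'c::comm_monoid_add"
      using sum.group[OF finD finP, of "ker m" f] partition_on_ker by blast
    have "?L = (\<Sum>i\<in>?D. \<phi> (ordered_prod (\<lambda>k. a N (i k)) {1..m}))"
      by (simp only: sum_power_eq_sum_ordered_prod[OF finite_atLeastAtMost] L.sum)
    also have "\<dots> = (\<Sum>i\<in>?D. complex_of_real t ^ card (ker_G (G N) m i))"
    proof (rule sum.cong[OF refl], rule bmt_independent_moment[OF assms(5)[OF N] assms(7)])
      fix i k assume "i \<in> ?D" "k \<in> {1..m}"
      then show "i k \<in> pverts (G N)" using assms(4)[OF N] by (auto dest: PiE_mem)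
    next
      fix v k :: nat assume "v \<in> pverts (G N)" "k \<ge> 1"
      then show "\<phi> (a N v ^ k) = complex_of_real t"
        using assms(4,6)[OF N] by (simp add: t_def)
    qed
    finally have L_eq: "?L = (\<Sum>i\<in>?D. complex_of_real t ^ card (ker_G (G N) m i))" .
    \<comment> \<open>On the fibre of \<open>\<pi>\<close> one may write \<open>ker m i\<close> for
      \<open>\<pi>\<close>; the summand then depends on \<open>i\<close> alone, and the main term
      can be compared with the expansion index by index.\<close>
    have "?R = (\<Sum>\<pi>\<in>?P. \<Sum>i | i \<in> ?D \<and> ker m i = \<pi>. complex_of_real (t ^ card (ker m i)) * b i)"
      unfolding sum_distrib_left
      by (intro sum.cong refl) (auto simp: b_def t_def divide_inverse power_inverse
          power_mult_distrib)
    then have "?L - ?R = (\<Sum>i\<in>?D. e i)"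
      unfolding L_eq group e_def by (simp only: sum_subtractf)
    also have "norm \<dots> \<le> (\<Sum>i\<in>?D. t ^ (card (ker m i) + 1))"
      using ker_G_moment_error_bound[OF t] by (intro sum_norm_le) (simp only: e_def b_def)
    also have "\<dots> = (\<Sum>\<pi>\<in>?P. \<Sum>i | i \<in> ?D \<and> ker m i = \<pi>. t ^ (card (ker m i) + 1))"
      by (simp only: group)
    also have "\<dots> = (\<Sum>\<pi>\<in>?P. real (card {i \<in> ?D. ker m i = \<pi>}) * t ^ (card \<pi> + 1))"
      by (intro sum.cong refl) simp
    also have "\<dots> \<le> (\<Sum>\<pi>\<in>?P. real N ^ card \<pi> * t ^ (card \<pi> + 1))"
    proof (intro sum_mono mult_right_mono)
      fix \<pi>
      show "real (card {i \<in> ?D. ker m i = \<pi>}) \<le> real N ^ card \<pi>"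
        using card_ker_fibre_le[of "{1..N}" m \<pi>]
        by (metis card_atLeastAtMost diff_Suc_1 finite_atLeastAtMost of_nat_le_iff of_nat_power)
    qed (use t in simp)
    also have "\<dots> = C * norm (complex_of_real (inverse (real N)))"
      unfolding C_def sum_distrib_right
    proof (intro sum.cong refl)
      fix \<pi>
      \<comment> \<open>Since \<open>N * t = lam\<close>, all but one of the factors
        \<open>t\<close> are absorbed by the count; the last one supplies
        \<open>1 / N\<close>.\<close>
      have "real N ^ card \<pi> * t ^ card \<pi> = lam ^ card \<pi>"
        using N by (simp add: t_def flip: power_mult_distrib)
      then show "real N ^ card \<pi> * t ^ (card \<pi> + 1) =
          lam ^ (card \<pi> + 1) * norm (complex_of_real (inverse (real N)))"
        by (simp add: t_def divide_inverse norm_inverse)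
    qed
    finally show ?thesis .
  qed
  \<comment> \<open>The bound is needed only for large \<open>N\<close>, so the finitely many
    \<open>N\<close> below \<open>lam\<close> or 1 are discarded.\<close>
  moreover have "\<forall>\<^sub>F N in sequentially. N \<ge> 1 \<and> real N \<ge> lam"
    using eventually_ge_at_top[of "max 1 (nat \<lceil>lam\<rceil>)"]
    by eventually_elim (auto simp: nat_le_iff ceiling_le_iff)
  ultimately show "\<forall>\<^sub>F N in sequentially. norm (\<phi> ((\<Sum>i=1..N. a N i) ^ m) -
            (\<Sum>\<pi> | partition_on {1..m} \<pi>.
               complex_of_real (lam ^ card \<pi> * inverse (real N ^ card \<pi>)) *
               (\<Sum>i | i \<in> {1..m} \<rightarrow>\<^sub>E {1..N} \<and> ker m i = \<pi>.
                  of_bool (subgraph (with_proj (relabelled_graph \<pi> i))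
                                    (with_proj (G N) \<restriction> (i ` {1..m}))))))
         \<le> C * norm (complex_of_real (inverse (real N)))"
    by (auto elim!: eventually_mono)
qed

end
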